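(* Let $J$ be an unbounded subinterval of $\mathbb{R}$ and $g:J\to\mathbb{R}$ a locally absolutely continuous function on $J$. Suppose that $g'\in L_\alpha(J)$ for some real $\alpha>1$, that the derivative $g':J\to\mathbb{R}$ is of locally bounded variation on $J$, and that there exist constants $V_J>0$ and $r\in(0,1]$ such that $$\left|\bigvee\nolimits_a^b(g')\right|\le V_J|b-a|^r\quad\text{for any } a,b\in J.$$ Then $g'\in L_\infty(J)$ and $$\|g'\|_{J,\infty}\le \frac{\alpha r+1}{\alpha^{\frac{\alpha r}{\alpha r+1}}\,r^{\frac{\alpha r}{\alpha r+1}}}\,\|g'\|_{J,\alpha}^{\frac{\alpha r}{\alpha r+1}}\,V_J^{\frac{1}{\alpha r+1}}.$$
   Context: $\|\cdot\|_{J,\infty}$ is the essential supremum norm on $J$ and $\|h\|_{J,\alpha}=\left(\int_J|h(t)|^\alpha\,dt\right)^{1/\alpha}$. For $a<b$, $\bigvee_a^b(h)$ denotes the total variation of $h$ on $[a,b]$; for arbitrary $a,b\in J$, $\left|\bigvee_a^b(h)\right|$ is the total variation of $h$ on the closed interval with endpoints $a$ and $b$ (in either order). *)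

theory Defs
  imports "HOL-Analysis.Analysis" "HOL-Probability.Essential_Supremum"
begin

definition abs_cont_on :: "real \<Rightarrow> real \<Rightarrow> (real \<Rightarrow> real) \<Rightarrow> bool" where
  "abs_cont_on a b h \<longleftrightarrow>
     (\<forall>\<epsilon>>0. \<exists>\<delta>>0. \<forall>P :: (real \<times> real) set.
        finite P \<and>
        (\<forall>(u, v)\<in>P. a \<le> u \<and> u < v \<and> v \<le> b) \<and>
        disjoint_family_on (\<lambda>(u, v). {u<..<v}) P \<and>
        (\<Sum>(u, v)\<in>P. v - u) < \<delta>
        \<longrightarrow> (\<Sum>(u, v)\<in>P. \<bar>h v - h u\<bar>) < \<epsilon>)"

definition locally_abs_cont_on :: "real set \<Rightarrow> (real \<Rightarrow> real) \<Rightarrow> bool" where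
  "locally_abs_cont_on J h \<longleftrightarrow> (\<forall>a b. a \<le> b \<longrightarrow> {a..b} \<subseteq> J \<longrightarrow> abs_cont_on a b h)"

(* Only meant for a <= b: otherwise there is no partition and the value is 0. *)
definition total_variation :: "real \<Rightarrow> real \<Rightarrow> (real \<Rightarrow> real) \<Rightarrow> ennreal" where
  "total_variation a b h =
     (SUP (n, x) \<in> {(n :: nat, x :: nat \<Rightarrow> real). x 0 = a \<and> x n = b \<and> (\<forall>i<n. x i < x (Suc i))}.
        ennreal (\<Sum>i<n. \<bar>h (x (Suc i)) - h (x i)\<bar>))"

definition locally_bounded_variation_on :: "real set \<Rightarrow> (real \<Rightarrow> real) \<Rightarrow> bool" where
  "locally_bounded_variation_on J h \<longleftrightarrow>
     (\<forall>a b. a \<le> b \<longrightarrow> {a..b} \<subseteq> J \<longrightarrow> total_variation a b h < \<infinity>)"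

definition Lp_space :: "real set \<Rightarrow> real \<Rightarrow> (real \<Rightarrow> real) set" where
  "Lp_space J \<alpha> = {h \<in> borel_measurable (lebesgue_on J).
     integrable (lebesgue_on J) (\<lambda>t. \<bar>h t\<bar> powr \<alpha>)}"

definition Lp_norm :: "real set \<Rightarrow> real \<Rightarrow> (real \<Rightarrow> real) \<Rightarrow> real" where
  "Lp_norm J \<alpha> h = (LINT t|lebesgue_on J. \<bar>h t\<bar> powr \<alpha>) powr (1 / \<alpha>)"

definition Linf_norm :: "real set \<Rightarrow> (real \<Rightarrow> real) \<Rightarrow> ereal" where
  "Linf_norm J h = esssup (lebesgue_on J) (\<lambda>t. ereal \<bar>h t\<bar>)"

definition Linf_space :: "real set \<Rightarrow> (real \<Rightarrow> real) set" where
  "Linf_space J = {h \<in> borel_measurable (lebesgue_on J). Linf_norm J h < \<infinity>}"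

(* A locally absolutely continuous function is differentiable almost everywhere, so its
   derivative is a function on J that agrees with the pointwise derivative almost everywhere;
   this includes the case of differentiability at every point of J (one-sided at end points). *)
definition is_derivative_on :: "real set \<Rightarrow> (real \<Rightarrow> real) \<Rightarrow> (real \<Rightarrow> real) \<Rightarrow> bool" where
  "is_derivative_on J g g' \<longleftrightarrow>
     (AE t in lebesgue_on J. (g has_real_derivative g' t) (at t within J))"

end

theory Submission
  imports Defs
begin

text \<open>
  The variation hypothesis says that \<open>g'\<close> is Hoelder continuous, so \<open>\<bar>g'\<bar> \<ge> \<bar>g' x\<bar> - V \<epsilon>\<^sup>r\<close> on an
  interval of length \<open>\<epsilon>\<close> in \<open>J\<close> with end point \<open>x\<close>, which exists for every \<open>\<epsilon>\<close> because \<open>J\<close> is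
  unbounded. Integrating the \<open>\<alpha>\<close>-th power gives \<open>\<bar>g' x\<bar> \<le> N / u + V u powr (\<alpha> r)\<close>, where
  \<open>N\<close> is the \<open>L\<^sub>\<alpha>\<close> norm and \<open>u = \<epsilon> powr (1 / \<alpha>)\<close>. The claimed bound is the minimum of the right-hand
  side over \<open>u\<close>, attained at \<open>u powr (\<alpha> r + 1) = N / (\<alpha> r V)\<close>.
\<close>

lemma abs_diff_le_total_variation:
  assumes "a < b"
  shows "ennreal \<bar>h b - h a\<bar> \<le> total_variation a b h"
proof -
  let ?x = "\<lambda>i::nat. if i = 0 then a else b"
  have "ennreal \<bar>h b - h a\<bar> = (\<lambda>(n, x). ennreal (\<Sum>i<n. \<bar>h (x (Suc i)) - h (x i)\<bar>)) (1, ?x)"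
    by simp
  also have "\<dots> \<le> total_variation a b h"
    unfolding total_variation_def by (rule SUP_upper) (use assms in auto)
  finally show ?thesis .
qed

text \<open>If both rays left \<open>J\<close>, convexity would trap \<open>J\<close> between a
  missed point on each side of \<open>x\<close>, making it bounded.\<close>

lemma unbounded_interval_ray:
  fixes J :: "real set"
  assumes J: "is_interval J" and "\<not> bounded J" and x: "x \<in> J"
  shows "{x..} \<subseteq> J \<or> {..x} \<subseteq> J"
proof (rule ccontr)
  assume "\<not> ?thesis"
  then obtain y z where "x \<le> y" "y \<notin> J" "z \<le> x" "z \<notin> J" by auto
  with J x have "J \<subseteq> {z..y}"
    unfolding is_interval_1 by (metis atLeastAtMost_iff linorder_le_cases subsetI)
  with \<open>\<not> bounded J\<close> show False
    using bounded_subset bounded_closed_interval by blast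
qed

lemma Lp_norm_nonneg: "0 \<le> Lp_norm J \<alpha> h"
  by (simp add: Lp_norm_def)

text \<open>A Chebyshev-type estimate: integrate the pointwise comparison of
  \<open>c powr \<alpha>\<close> times the indicator of the interval with
  \<open>\<bar>h t\<bar> powr \<alpha>\<close>, then take the root.\<close>

lemma lower_bound_le_Lp_norm:
  assumes h: "h \<in> Lp_space J \<alpha>" and "\<alpha> > 0" and J: "J \<in> sets lebesgue"
    and "a \<le> b" and sub: "{a..b} \<subseteq> J" and "0 \<le> c" and c: "\<And>t. t \<in> {a..b} \<Longrightarrow> c \<le> \<bar>h t\<bar>"
  shows "c * (b - a) powr (1 / \<alpha>) \<le> Lp_norm J \<alpha> h"
proof -
  let ?M = "lebesgue_on J"
  have meas: "{a..b} \<in> sets ?M" "measure ?M {a..b} = b - a"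
    "emeasure ?M {a..b} = ennreal (b - a)"
    using sub J \<open>a \<le> b\<close>
    by (auto simp: sets_restrict_space_iff measure_restrict_space emeasure_restrict_space)
  have "c powr \<alpha> * (b - a) = (LINT t|?M. c powr \<alpha> * indicator {a..b} t)"
    using meas sub by (simp add: inf_absorb2 Int_absorb2)
  also have "\<dots> \<le> (LINT t|?M. \<bar>h t\<bar> powr \<alpha>)"
  proof (rule integral_mono)
    show "integrable ?M (\<lambda>t. c powr \<alpha> * indicator {a..b} t)"
      using meas by simp
    show "integrable ?M (\<lambda>t. \<bar>h t\<bar> powr \<alpha>)"
      using h by (simp add: Lp_space_def)
    show "c powr \<alpha> * indicator {a..b} t \<le> \<bar>h t\<bar> powr \<alpha>" for t
      using c[of t] \<open>0 \<le> c\<close> \<open>\<alpha> > 0\<close> by (auto simp: indicator_def intro: powr_mono2)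
  qed
  finally have "(c powr \<alpha> * (b - a)) powr (1 / \<alpha>) \<le> Lp_norm J \<alpha> h"
    unfolding Lp_norm_def using \<open>\<alpha> > 0\<close> \<open>a \<le> b\<close> by (intro powr_mono2) auto
  then show ?thesis
    using \<open>\<alpha> > 0\<close> \<open>a \<le> b\<close> \<open>0 \<le> c\<close> by (simp add: powr_mult powr_powr)
qed

lemma le_optimal_value:
  fixes M N V p :: real
  assumes "0 \<le> N" "0 < V" "0 < p"
    and bound: "\<And>u. 0 < u \<Longrightarrow> M \<le> N / u + V * u powr p"
  shows "M \<le> (p + 1) / p powr (p / (p + 1)) * N powr (p / (p + 1)) * V powr (1 / (p + 1))"
proof (cases "N = 0")
  case True
  have "M \<le> 0"
  proof (rule ccontr)
    assume "\<not> M \<le> 0"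
    \<comment> \<open>For \<open>N = 0\<close> the infimum over \<open>u\<close> is 0 but is not
      attained. This \<open>u\<close> solves \<open>V * u powr p = M / 2\<close>, which contradicts
      \<open>M > 0\<close>.\<close>
    then have "M \<le> V * ((M / (2 * V)) powr (1 / p)) powr p"
      using bound[of "(M / (2 * V)) powr (1 / p)"] True \<open>0 < V\<close> by simp
    also have "\<dots> = M / 2"
      using \<open>\<not> M \<le> 0\<close> \<open>0 < V\<close> \<open>0 < p\<close> by (simp add: powr_powr)
    finally show False using \<open>\<not> M \<le> 0\<close> by simp
  qed
  with True show ?thesis by simp
next
  case False
  with \<open>0 \<le> N\<close> have N: "0 < N" by simp
  define q where "q = 1 / (p + 1)"
  \<comment> \<open>The zero of the derivative of the bound:
    \<open>N / u^2 = p * V * u powr (p - 1)\<close>.\<close>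
  define u where "u = (N / (p * V)) powr q"
  have q: "p / (p + 1) = 1 - q" "p * q = 1 - q" "q * p = 1 - q"
    using \<open>0 < p\<close> by (auto simp: q_def field_simps)
  have u: "0 < u" using N assms by (simp add: u_def)
  \<comment> \<open>The value of the first term at this \<open>u\<close>. Criticality makes the
    second term \<open>A / p\<close>, so the two add up to \<open>A * (p + 1) / p\<close>.\<close>
  define A where "A = N powr (1 - q) * p powr q * V powr q"
  have "N / u = A"
    using N assms by (simp add: A_def u_def powr_divide powr_mult powr_diff field_simps)
  moreover have "V * u powr p = A / p"
    using N assms by (simp add: A_def u_def powr_powr q powr_divide powr_mult powr_diff field_simps)
  ultimately have "M \<le> A * ((p + 1) / p)"
    using bound[OF u] \<open>0 < p\<close> by (simp add: distrib_left add_divide_distrib)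
  also have "\<dots> = (p + 1) / p powr (1 - q) * N powr (1 - q) * V powr q"
    using \<open>0 < p\<close> by (simp add: A_def powr_diff mult_ac)
  finally show ?thesis using q by (simp add: q_def)
qed

lemma abs_le_Lp_norm_add_holder:
  fixes J :: "real set"
  assumes J: "is_interval J" "\<not> bounded J" and h: "h \<in> Lp_space J \<alpha>" and "\<alpha> > 0"
    and "0 \<le> V" "0 < r"
    and holder: "\<And>s t. s \<in> J \<Longrightarrow> t \<in> J \<Longrightarrow> \<bar>h t - h s\<bar> \<le> V * \<bar>t - s\<bar> powr r"
    and "x \<in> J" "0 < u"
  shows "\<bar>h x\<bar> \<le> Lp_norm J \<alpha> h / u + V * u powr (\<alpha> * r)"
proof -
  \<comment> \<open>The interval length; \<open>u\<close> is its root because that is the factor the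
    norm estimate produces.\<close>
  define e where "e = u powr \<alpha>"
  have e: "0 < e" "e powr (1 / \<alpha>) = u" "e powr r = u powr (\<alpha> * r)"
    using \<open>0 < u\<close> \<open>\<alpha> > 0\<close> by (auto simp: e_def powr_powr)
  obtain a where a: "{a..a + e} \<subseteq> J" "a = x \<or> a + e = x"
  proof -
    consider "{x..} \<subseteq> J" | "{..x} \<subseteq> J"
      using unbounded_interval_ray[OF J \<open>x \<in> J\<close>] by blast
    then show thesis
    proof cases
      case 1
      then have "{x..x + e} \<subseteq> J" by (auto simp: subset_iff)
      with that[of x] show thesis by simp
    next
      case 2
      then have "{x - e..x} \<subseteq> J" by (auto simp: subset_iff)
      with that[of "x - e"] show thesis by simp
    qed
  qed
  define c where "c = \<bar>h x\<bar> - V * e powr r"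
  \<comment> \<open>Taking powers requires a nonnegative lower bound; for \<open>c \<le> 0\<close>
    the claim follows from the sign of the norm.\<close>
  have "c \<le> Lp_norm J \<alpha> h / u"
  proof (cases "c \<le> 0")
    case True
    then show ?thesis
      using Lp_norm_nonneg[of J \<alpha> h] \<open>0 < u\<close> by (meson divide_nonneg_pos order_trans)
  next
    case False
    have "c \<le> \<bar>h t\<bar>" if t: "t \<in> {a..a + e}" for t
    proof -
      \<comment> \<open>As \<open>x\<close> is an end point of the interval,
        \<open>\<bar>x - t\<bar>\<close> is at most \<open>e\<close>; the reverse triangle
        inequality then gives the lower bound \<open>c\<close>.\<close>
      have "\<bar>h x - h t\<bar> \<le> V * \<bar>x - t\<bar> powr r"
        using t a \<open>x \<in> J\<close> by (intro holder) auto
      also have "\<dots> \<le> V * e powr r"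
        using t a \<open>0 \<le> V\<close> \<open>0 < r\<close> by (intro mult_left_mono powr_mono2) auto
      finally show ?thesis by (simp add: c_def)
    qed
    moreover have "J \<in> sets lebesgue"
      using J real_interval_borel_measurable[of J] by simp
    ultimately have "c * (a + e - a) powr (1 / \<alpha>) \<le> Lp_norm J \<alpha> h"
      using lower_bound_le_Lp_norm[OF h \<open>\<alpha> > 0\<close>, of a "a + e" c] a e False by auto
    then show ?thesis using e \<open>0 < u\<close> by (simp add: field_simps)
  qed
  then show ?thesis by (simp add: c_def e)
qed

theorem theorem5:
  fixes J :: "real set" and g g' :: "real \<Rightarrow> real" and \<alpha> r V :: real
  assumes "is_interval J" and "\<not> bounded J"
    and "locally_abs_cont_on J g"
    and "is_derivative_on J g g'"
    and "\<alpha> > 1" and "g' \<in> Lp_space J \<alpha>"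
    and "locally_bounded_variation_on J g'"
    and "V > 0" and "0 < r" and "r \<le> 1"
    and "\<And>a b. a \<in> J \<Longrightarrow> b \<in> J \<Longrightarrow>
           total_variation (min a b) (max a b) g' \<le> ennreal (V * \<bar>b - a\<bar> powr r)"
  shows "g' \<in> Linf_space J \<and>
    Linf_norm J g' \<le> ereal
      ((\<alpha> * r + 1) / (\<alpha> powr (\<alpha> * r / (\<alpha> * r + 1)) * r powr (\<alpha> * r / (\<alpha> * r + 1)))
        * Lp_norm J \<alpha> g' powr (\<alpha> * r / (\<alpha> * r + 1))
        * V powr (1 / (\<alpha> * r + 1)))"
proof -
  define B where "B = (\<alpha> * r + 1) / (\<alpha> powr (\<alpha> * r / (\<alpha> * r + 1)) * r powr (\<alpha> * r / (\<alpha> * r + 1)))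
        * Lp_norm J \<alpha> g' powr (\<alpha> * r / (\<alpha> * r + 1)) * V powr (1 / (\<alpha> * r + 1))"
  have holder: "\<bar>g' t - g' s\<bar> \<le> V * \<bar>t - s\<bar> powr r" if st: "s \<in> J" "t \<in> J" for s t
  proof (cases "s = t")
    case False
    \<comment> \<open>Sorting the points by \<open>min\<close> and \<open>max\<close> fits the
      orientation of \<open>total_variation\<close>; the one-step partition needs them
      distinct.\<close>
    then have "ennreal \<bar>g' (max s t) - g' (min s t)\<bar> \<le> ennreal (V * \<bar>t - s\<bar> powr r)"
      using assms(11)[OF st] by (intro order_trans[OF abs_diff_le_total_variation]) auto
    then have "\<bar>g' (max s t) - g' (min s t)\<bar> \<le> V * \<bar>t - s\<bar> powr r"
      using \<open>V > 0\<close> by (simp add: ennreal_le_iff)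
    then show ?thesis by (auto simp: max_def min_def abs_minus_commute split: if_splits)
  qed simp
  have "\<bar>g' x\<bar> \<le> B" if "x \<in> J" for x
  proof -
    have "\<bar>g' x\<bar> \<le> Lp_norm J \<alpha> g' / u + V * u powr (\<alpha> * r)" if "0 < u" for u
      using assms holder \<open>x \<in> J\<close> that by (intro abs_le_Lp_norm_add_holder) auto
    \<comment> \<open>Optimise with \<open>p = \<alpha> * r\<close>; splitting the power of this
      product afterwards gives the constant in \<open>B\<close>.\<close>
    then have "\<bar>g' x\<bar> \<le> (\<alpha> * r + 1) / (\<alpha> * r) powr (\<alpha> * r / (\<alpha> * r + 1))
        * Lp_norm J \<alpha> g' powr (\<alpha> * r / (\<alpha> * r + 1)) * V powr (1 / (\<alpha> * r + 1))"
      using assms by (intro le_optimal_value Lp_norm_nonneg) auto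
    then show ?thesis using assms by (simp add: B_def powr_mult)
  qed
  moreover have g': "g' \<in> borel_measurable (lebesgue_on J)"
    using assms by (simp add: Lp_space_def)
  \<comment> \<open>The bound holds at every point of \<open>J\<close>, hence almost everywhere, and
    so limits the essential supremum.\<close>
  ultimately have "Linf_norm J g' \<le> ereal B"
    unfolding Linf_norm_def by (intro esssup_I) auto
  moreover from this have "g' \<in> Linf_space J"
    using g' by (auto simp: Linf_space_def intro: le_less_trans)
  ultimately show ?thesis unfolding B_def by blast
qed

end
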